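(* Let $m\geq 3$ be an odd integer and let $p$ be an odd prime such that $2m^p-1$ is square-free. Then the class number of $\mathbb{Q}(\sqrt{1-2m^p})$ is divisible by $p$.
   Context: The class number of a number field is the order of its ideal class group. *)

theory Defs
  imports
    "HOL-Computational_Algebra.Computational_Algebra"
    "HOL-Algebra.Algebraic_Closure_Type"
    "HOL-Algebra.Generated_Fields"
    "HOL-Algebra.Ideal_Product"
    "HOL-Algebra.Coset"
begin

text \<open>
  Number fields are represented as subfields of the complex numbers, that is, as sets of
  complex numbers. Every number field embeds into the complex numbers, and the ideal class
  group does not depend on the embedding.
\<close>

abbreviation complex_ring :: "complex ring" where
  "complex_ring \<equiv> ring_of_type_algebra"

definition rat_adjoin :: "complex \<Rightarrow> complex set" where
  \<comment> \<open>A subfield of the complex numbers contains the rationals, so they need not be listed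
      among the generators.\<close>
  "rat_adjoin \<alpha> = generate_field complex_ring {\<alpha>}"

definition ring_of_integers :: "complex set \<Rightarrow> complex set" where
  "ring_of_integers K = {x \<in> K. algebraic_int x}"

definition fractional_ideal :: "complex set \<Rightarrow> complex set \<Rightarrow> bool" where
  "fractional_ideal K I \<longleftrightarrow>
     I \<subseteq> K \<and> 0 \<in> I \<and> I \<noteq> {0} \<and>
     (\<forall>x\<in>I. \<forall>y\<in>I. x + y \<in> I) \<and>
     (\<forall>r\<in>ring_of_integers K. \<forall>x\<in>I. r * x \<in> I) \<and>
     (\<exists>d\<in>ring_of_integers K. d \<noteq> 0 \<and> (\<forall>x\<in>I. d * x \<in> ring_of_integers K))"

definition principal_fractional_ideals :: "complex set \<Rightarrow> complex set set" where
  "principal_fractional_ideals K = {(\<lambda>r. a * r) ` ring_of_integers K |a. a \<in> K \<and> a \<noteq> 0}"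

text \<open>
  The library's \<^const>\<open>ideal_prod\<close> of two sets consists of all finite sums of
  products. Taken in the ring of complex numbers, it is the product of fractional ideals.
\<close>

definition fractional_ideal_group :: "complex set \<Rightarrow> complex set monoid" where
  "fractional_ideal_group K =
     \<lparr>carrier = {I. fractional_ideal K I}, monoid.mult = ideal_prod complex_ring,
      one = ring_of_integers K\<rparr>"

definition ideal_class_group :: "complex set \<Rightarrow> complex set set monoid" where
  "ideal_class_group K = fractional_ideal_group K Mod principal_fractional_ideals K"

text \<open>
  As \<^const>\<open>Coset.order\<close> is a cardinality, it is \<open>0\<close> for an infinite group. Statements about
  the class number should therefore come with the finiteness of the class group.
\<close>

definition class_number :: "complex set \<Rightarrow> nat" where
  "class_number K = Coset.order (ideal_class_group K)"

end

theory Submission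
  imports Defs "HOL-Analysis.Kronecker_Approximation_Theorem"
begin

text \<open>
  Put \<open>D = 2 * m ^ p - 1\<close>, \<open>c = 1 - m ^ p\<close> and \<open>w = sqrt (- D)\<close>. As \<open>D\<close> is square-free and congruent
  to 1 modulo 4, the ring of integers is \<open>\<int>[w]\<close>. The element \<open>c + w\<close> has norm
  \<open>c\<^sup>2 + D = m ^ (2 * p)\<close> and is coprime to its conjugate, so the ideal it generates is the \<open>p\<close>-th
  power of the ideal \<open>I = (m\<^sup>2, c + w)\<close>. If \<open>I\<close> were generated by some \<open>b\<close>, then \<open>b\<close> would have norm
  \<open>m\<^sup>2 < D\<close>, hence be the rational integer \<open>m\<close> up to sign, which does not divide \<open>c + w\<close>. So the class
  of \<open>I\<close> has order \<open>p\<close>.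
\<close>

section \<open>Products of complex subsets\<close>

text \<open>For an infinite class group \<open>order\<close> would be 0 and divisibility by
  \<open>p\<close> would hold vacuously, so finiteness is proved alongside; it comes from Dirichlet
  approximation instead of Minkowski's theorem. The quotient must also be shown to be a group, which
  needs inverses of fractional ideals. Hurwitz's argument supplies them without unique factorisation
  into prime ideals. In the same spirit the powers of \<open>I\<close> are computed explicitly:
  \<open>I ^ k\<close> is the integer span of \<open>m ^ (2 * k)\<close> and \<open>c + w\<close>
  for \<open>k \<le> p\<close>, so that only gcds of integers enter.

  The value of \<open>c\<close> comes from the identity (1 - y)^2 + (2 * y - 1) = y^2 at
  \<open>y = m ^ p\<close>, which turns the norm of \<open>c + w\<close> into a perfect power; it is
  also congruent to 1 modulo \<open>m\<close>, which yields the coprimality. Primality of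
  \<open>p\<close> is what turns "the \<open>p\<close>-th power is principal, the ideal is not" into
  order exactly \<open>p\<close>.\<close>

abbreviation ideal_mult :: "complex set \<Rightarrow> complex set \<Rightarrow> complex set" (infixl \<open>\<star>\<close> 70) where
  "I \<star> J \<equiv> ideal_prod complex_ring I J"

lemma complex_ring_simps [simp]:
  "x \<otimes>\<^bsub>complex_ring\<^esub> y = x * y" "x \<oplus>\<^bsub>complex_ring\<^esub> y = x + y"
  "\<one>\<^bsub>complex_ring\<^esub> = 1" "\<zero>\<^bsub>complex_ring\<^esub> = 0" "carrier complex_ring = UNIV"
  by (simp_all add: ring_of_type_algebra_def)

lemma complex_ring_minus [simp]: "\<ominus>\<^bsub>complex_ring\<^esub> x = - x"
proof -
  interpret cring complex_ring by (rule cring_from_type_algebra)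
  show ?thesis using minus_equality[of "- x" x] by simp
qed

lemma complex_ring_inv [simp]: "x \<noteq> 0 \<Longrightarrow> inv\<^bsub>complex_ring\<^esub> x = inverse x"
proof -
  assume "x \<noteq> 0"
  interpret cring complex_ring by (rule cring_from_type_algebra)
  show ?thesis using \<open>x \<noteq> 0\<close> by (intro inv_unique'[symmetric]) simp_all
qed

lemma ideal_mult_prod: "x \<in> I \<Longrightarrow> y \<in> J \<Longrightarrow> x * y \<in> I \<star> J"
  using ideal_prod.prod[of x I y J complex_ring] by simp

lemma ideal_mult_sum: "x \<in> I \<star> J \<Longrightarrow> y \<in> I \<star> J \<Longrightarrow> x + y \<in> I \<star> J"
  using ideal_prod.sum[of x complex_ring I J y] by simp

lemma ideal_mult_induct [consumes 1, case_names prod sum]: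
  assumes "x \<in> I \<star> J"
    and "\<And>i j. i \<in> I \<Longrightarrow> j \<in> J \<Longrightarrow> P (i * j)"
    and "\<And>x y. x \<in> I \<star> J \<Longrightarrow> P x \<Longrightarrow> y \<in> I \<star> J \<Longrightarrow> P y \<Longrightarrow> P (x + y)"
  shows "P x"
  using assms(1) by (induction rule: ideal_prod.induct) (simp_all add: assms)

lemma ideal_mult_subset:
  assumes "\<And>i j. i \<in> I \<Longrightarrow> j \<in> J \<Longrightarrow> i * j \<in> T"
    and "\<And>x y. x \<in> T \<Longrightarrow> y \<in> T \<Longrightarrow> x + y \<in> T"
  shows "I \<star> J \<subseteq> T"
proof
  fix x assume "x \<in> I \<star> J"
  then show "x \<in> T" by (induction rule: ideal_mult_induct) (auto intro: assms)
qed

lemma ideal_mult_commute: "I \<star> J = J \<star> I"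
proof -
  have "I \<star> J \<subseteq> J \<star> I" for I J
    by (rule ideal_mult_subset)
       (metis ideal_mult_prod mult.commute, rule ideal_mult_sum)
  then show ?thesis by blast
qed

lemma ideal_mult_closed:
  assumes "\<And>x. x \<in> I \<Longrightarrow> r * x \<in> I" and "x \<in> I \<star> J"
  shows "r * x \<in> I \<star> J"
  using assms(2)
  by (induction rule: ideal_mult_induct)
     (auto simp: distrib_left mult.assoc[symmetric] intro: ideal_mult_prod ideal_mult_sum assms(1))

lemma ideal_mult_assoc: "(I \<star> J) \<star> L = I \<star> (J \<star> L)"
proof -
  have sub: "(I \<star> J) \<star> L \<subseteq> I \<star> (J \<star> L)" for I J L
  proof (rule ideal_mult_subset)
    fix x l assume "x \<in> I \<star> J" and l: "l \<in> L"
    then show "x * l \<in> I \<star> (J \<star> L)"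
      by (induction rule: ideal_mult_induct)
         (auto simp: distrib_right mult.assoc intro: ideal_mult_prod ideal_mult_sum l)
  qed (rule ideal_mult_sum)
  \<comment> \<open>Commutativity reverses the order of the factors, so the inclusion already shown,
    applied to \<open>L\<close>, \<open>J\<close>, \<open>I\<close>, is the converse one.\<close>
  have "I \<star> (J \<star> L) = (L \<star> J) \<star> I" by (simp add: ideal_mult_commute)
  also have "\<dots> \<subseteq> L \<star> (J \<star> I)" by (rule sub)
  also have "\<dots> = (I \<star> J) \<star> L" by (simp add: ideal_mult_commute)
  finally show ?thesis using sub by blast
qed

lemma ideal_mult_scale: "((*) a ` I) \<star> J = (*) a ` (I \<star> J)"
proof
  show "((*) a ` I) \<star> J \<subseteq> (*) a ` (I \<star> J)"
  proof (rule ideal_mult_subset)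
    fix x y assume "x \<in> (*) a ` (I \<star> J)" "y \<in> (*) a ` (I \<star> J)"
    then show "x + y \<in> (*) a ` (I \<star> J)"
      by (auto simp: distrib_left[symmetric] intro: ideal_mult_sum)
  qed (auto simp: mult.assoc intro: ideal_mult_prod)
  show "(*) a ` (I \<star> J) \<subseteq> ((*) a ` I) \<star> J"
  proof
    fix y assume "y \<in> (*) a ` (I \<star> J)"
    then obtain x where "x \<in> I \<star> J" "y = a * x" by blast
    then have "a * x \<in> ((*) a ` I) \<star> J"
      by (induction arbitrary: y rule: ideal_mult_induct)
         (auto simp: distrib_left mult.assoc[symmetric] intro: ideal_mult_prod ideal_mult_sum)
    then show "y \<in> ((*) a ` I) \<star> J" using \<open>y = a * x\<close> by simp
  qed
qed

lemma scale_scale: "(*) a ` (*) b ` I = (*) (a * b) ` I" for a b :: complex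
  by (auto simp: image_image mult.assoc)

section \<open>Integers and algebraic integers\<close>

text \<open>After division by the gcd, the square of the remaining part of \<open>e\<close> is
  coprime to the remaining part of \<open>b\<close> and must divide \<open>D\<close>, hence is a
  unit. This bounds the denominator of the \<open>w\<close>-coordinate of an algebraic
  integer.\<close>

lemma squarefree_square_dvd_mult:
  fixes D e b :: int
  assumes "squarefree D" "e\<^sup>2 dvd D * b\<^sup>2" "e \<noteq> 0"
  shows "e dvd b"
proof -
  define g where "g = gcd e b"
  have "g \<noteq> 0" using assms(3) by (simp add: g_def)
  obtain e' b' where eb: "e = e' * g" "b = b' * g" "coprime e' b'"
    using gcd_coprime_exists[of e b] assms(3) unfolding g_def by force
  have "g\<^sup>2 * e'\<^sup>2 dvd g\<^sup>2 * (D * b'\<^sup>2)"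
    using assms(2) by (simp add: eb power_mult_distrib ac_simps)
  then have "e'\<^sup>2 dvd D * b'\<^sup>2" using \<open>g \<noteq> 0\<close> by simp
  moreover have "coprime (e'\<^sup>2) (b'\<^sup>2)" using eb(3) by simp
  ultimately have "e'\<^sup>2 dvd D" by (simp add: coprime_dvd_mult_left_iff)
  then have "is_unit e'" using assms(1) by (rule squarefreeD[rotated])
  then show ?thesis unfolding eb by (simp add: mult_dvd_mono unit_imp_dvd)
qed

text \<open>Modulo 4 the form is a sum of two squares, each 0 or 1. This is the point that rules out
  half-integral coordinates in the ring of integers.\<close>

lemma sum_squares_dvd_4:
  fixes a b D :: int
  assumes "D mod 4 = 1" "4 dvd a\<^sup>2 + D * b\<^sup>2"
  shows "even a" "even b"
proof -
  have sq: "x\<^sup>2 mod 4 = (if even x then 0 else 1)" for x :: int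
  proof (cases "even x")
    case False
    then obtain k where "x = 2 * k + 1" by (elim oddE)
    then have "x\<^sup>2 = 1 + 4 * (k * k + k)" by (simp add: power2_eq_square algebra_simps)
    then show ?thesis using False by presburger
  qed (auto elim!: evenE simp: power2_eq_square)
  define k where "k = D div 4"
  have "D = 4 * k + 1" using mult_div_mod_eq[of 4 D] assms(1) by (simp add: k_def)
  then have "a\<^sup>2 + D * b\<^sup>2 = (a\<^sup>2 + b\<^sup>2) + 4 * (k * b\<^sup>2)" by (simp add: algebra_simps)
  then have "4 dvd a\<^sup>2 + b\<^sup>2" using assms(2) by (metis dvd_add_left_iff dvd_triv_left)
  then have "(a\<^sup>2 mod 4 + b\<^sup>2 mod 4) mod 4 = 0" by (simp add: mod_simps dvd_eq_mod_eq_0)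
  then show "even a" "even b" by (auto simp: sq split: if_splits)
qed

text \<open>The generator is the least positive element, since remainders modulo it stay in the
  subgroup. It serves to find an integral basis of an ideal one coordinate at a time.\<close>

lemma int_subgroup_principal:
  fixes S :: "int set"
  assumes "0 \<in> S" "\<And>x y. x \<in> S \<Longrightarrow> y \<in> S \<Longrightarrow> x - y \<in> S"
  obtains g where "S = range ((*) g)"
proof -
  have neg: "- x \<in> S" if "x \<in> S" for x using assms(2)[OF assms(1) that] by simp
  have add: "x + y \<in> S" if "x \<in> S" "y \<in> S" for x y using assms(2)[OF that(1) neg[OF that(2)]] by simp
  have nat_mult: "int k * x \<in> S" if "x \<in> S" for k x
    by (induction k) (auto simp: assms(1) distrib_right that add)
  have mult: "k * x \<in> S" if "x \<in> S" for k x
    using nat_mult[OF that, of "nat k"] nat_mult[OF neg[OF that], of "nat (- k)"]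
    by (cases "k \<ge> 0") auto
  show thesis
  proof (cases "S = {0}")
    case True
    then show ?thesis using that[of 0] by auto
  next
    case False
    then obtain x where x: "x \<in> S" "x \<noteq> 0" using assms(1) by blast
    then have "\<exists>n. n > 0 \<and> int n \<in> S"
      using neg[OF x(1)] by (intro exI[of _ "nat \<bar>x\<bar>"]) (auto simp: abs_if)
    define n where "n = (LEAST n. n > 0 \<and> int n \<in> S)"
    have n: "n > 0" "int n \<in> S"
      using LeastI_ex[OF \<open>\<exists>n. n > 0 \<and> int n \<in> S\<close>] by (auto simp: n_def)
    have "int n dvd y" if "y \<in> S" for y
    proof (rule ccontr)
      assume "\<not> int n dvd y"
      then have "y mod int n > 0" "y mod int n < int n"
        using n(1) by (simp_all add: dvd_eq_mod_eq_0 order.not_eq_order_implies_strict)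
      then have "nat (y mod int n) > 0" "nat (y mod int n) < n" "int (nat (y mod int n)) = y mod int n"
        by linarith+
      moreover have "y mod int n \<in> S"
        using assms(2)[OF that mult[OF n(2), of "y div int n"]] by (simp add: minus_div_mult_eq_mod)
      ultimately show False
        using not_less_Least[of "nat (y mod int n)" "\<lambda>n. n > 0 \<and> int n \<in> S"]
        unfolding n_def[symmetric] by simp
    qed
    then have "S = range ((*) (int n))"
      using mult[OF n(2)] by (auto simp: dvd_def mult.commute)
    then show ?thesis using that by blast
  qed
qed

lemma poly_of_int_hom:
  fixes x :: "'a :: comm_ring_1"
  shows "poly (map_poly of_int (p + q)) x = poly (map_poly of_int p) x + poly (map_poly of_int q) x"
    and "poly (map_poly of_int (smult c p)) x = of_int c * poly (map_poly of_int p) x"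
    and "poly (map_poly of_int (p * q)) x = poly (map_poly of_int p) x * poly (map_poly of_int q) x"
proof -
  have add: "map_poly of_int (p + q) = (map_poly of_int p + map_poly of_int q :: 'a poly)" for p q
    by (intro poly_eqI) (simp add: coeff_map_poly)
  show "poly (map_poly of_int (p + q)) x = poly (map_poly of_int p) x + poly (map_poly of_int q) x"
    by (simp add: add)
  have smult: "map_poly of_int (smult c p) = smult (of_int c) (map_poly of_int p :: 'a poly)" for c p
    by (intro poly_eqI) (simp add: coeff_map_poly)
  show "poly (map_poly of_int (smult c p)) x = of_int c * poly (map_poly of_int p) x"
    by (simp add: smult)
  show "poly (map_poly of_int (p * q)) x = poly (map_poly of_int p) x * poly (map_poly of_int q) x"
    by (induction p) (simp_all add: map_poly_pCons add smult algebra_simps)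
qed

text \<open>Gauss's lemma: as \<open>f\<close> is primitive and the quotient of \<open>p\<close> by \<open>f\<close> over the rationals is exact, it is
  integral. The pseudo-remainder vanishes because it is linear with a non-real root.\<close>

lemma primitive_quadratic_monic:
  fixes x :: complex and f :: "int poly"
  assumes "algebraic_int x" "Im x \<noteq> 0"
    and f: "degree f = 2" "Polynomial.content f = 1" "poly (map_poly of_int f) x = 0"
  shows "is_unit (lead_coeff f)"
proof -
  obtain p where p: "poly (map_poly of_int p) x = 0" "lead_coeff p = 1"
    using assms(1) unfolding algebraic_int_altdef_ipoly by blast
  have "f \<noteq> 0" using f(1) by auto
  obtain h r where "pseudo_divmod p f = (h, r)" by fastforce
  from pseudo_divmod[OF \<open>f \<noteq> 0\<close> this] obtain c where
    c: "smult c p = f * h + r" "r = 0 \<or> degree r < degree f" "c \<noteq> 0"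
    using \<open>f \<noteq> 0\<close> by (metis leading_coeff_0_iff power_not_zero)
  have "degree r < 2" using c(2) f(1) by auto
  define u v where "u = coeff r 0" and "v = coeff r 1"
  have "r = [:u, v:]"
  proof (rule poly_eqI)
    fix n show "coeff r n = coeff [:u, v:] n"
      using \<open>degree r < 2\<close> by (cases n rule: old.nat.exhaust; cases "n - 1")
        (auto simp: u_def v_def coeff_eq_0 coeff_pCons split: nat.splits)
  qed
  have "poly (map_poly of_int (smult c p)) x = poly (map_poly of_int (f * h + r)) x" using c(1) by simp
  then have "poly (map_poly of_int r) x = 0"
    using p(1) f(3) by (simp add: poly_of_int_hom)
  then have "of_int u + x * of_int v = 0" by (simp add: \<open>r = _\<close> map_poly_pCons)
  moreover from this have "v = 0" using assms(2) by (auto simp: complex_eq_iff)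
  ultimately have "r = 0" by (simp add: \<open>r = _\<close>)
  then have fh: "smult c p = f * h" using c(1) by simp
  have "is_unit (Polynomial.content p)" using content_dvd_coeff[of p "degree p"] p(2) by simp
  then have "Polynomial.content p = 1" by (metis content_dvd_contentI normalize_content is_unit_normalize)
  then have "Polynomial.content h = normalize c"
    using arg_cong[OF fh, of Polynomial.content] f(2) by (simp add: content_mult)
  then have "[:c:] dvd h" using const_poly_dvd_iff_dvd_content[of c h] by simp
  then obtain h' where "h = smult c h'" by (auto elim: dvdE)
  then have "p = f * h'" using fh c(3) by (metis mult_smult_right smult_cancel)
  then have "lead_coeff f * lead_coeff h' = 1" using p(2) by (simp add: lead_coeff_mult)
  then show ?thesis by (metis dvd_triv_left)
qed

lemma algebraic_int_quadratic:
  assumes "x + cnj x = of_int t" "x * cnj x = of_int n"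
  shows "algebraic_int x"
proof (rule algebraic_int.intros)
  let ?p = "[:of_int n, - of_int t, 1:] :: complex poly"
  show "lead_coeff ?p = 1" by simp
  show "\<forall>i. coeff ?p i \<in> \<int>" by (auto simp: coeff_pCons split: nat.splits)
  show "poly ?p x = 0" using assms by (simp add: algebra_simps flip: assms)
qed

section \<open>The ring of integers of an imaginary quadratic field\<close>

locale imaginary_quadratic =
  fixes D :: int
  assumes D_gt_1: "D > 1" and squarefree_D: "squarefree D" and D_mod_4: "D mod 4 = 1"
begin

definition w :: complex where "w = csqrt (of_int (- D))"
abbreviation K :: "complex set" where "K \<equiv> rat_adjoin w"
abbreviation R :: "complex set" where "R \<equiv> ring_of_integers K"

lemma Re_w [simp]: "Re w = 0" and Im_w [simp]: "Im w = sqrt (of_int D)"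
  using D_gt_1 by (simp_all add: w_def)

lemma cnj_w [simp]: "cnj w = - w"
  by (simp add: complex_eq_iff)

text \<open>The second equation is the first under a further factor: in right-associated products
  the simplifier meets \<open>w * w\<close> only in that shape.\<close>

lemma w_square: "w * w = - of_int D" "w * (w * z) = - of_int D * z"
proof -
  show "w * w = - of_int D"
    using power2_csqrt[of "of_int (- D)"] by (simp add: w_def power2_eq_square)
  then show "w * (w * z) = - of_int D * z" by (simp add: mult.assoc[symmetric])
qed

lemma K_w: "w \<in> K" and K_1: "1 \<in> K"
  unfolding rat_adjoin_def
  using generate_field.incl[of w "{w}" complex_ring] generate_field.one[of complex_ring "{w}"] by simp_all

lemma K_uminus: "x \<in> K \<Longrightarrow> - x \<in> K"
  and K_add: "x \<in> K \<Longrightarrow> y \<in> K \<Longrightarrow> x + y \<in> K"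
  and K_mult: "x \<in> K \<Longrightarrow> y \<in> K \<Longrightarrow> x * y \<in> K"
  unfolding rat_adjoin_def
  using generate_field.a_inv[of x complex_ring "{w}"] generate_field.eng_add[of x complex_ring "{w}" y]
    generate_field.eng_mult[of x complex_ring "{w}" y] by simp_all

lemma K_0: "0 \<in> K" using K_add[OF K_1 K_uminus[OF K_1]] by simp

lemma K_inverse: "x \<in> K \<Longrightarrow> inverse x \<in> K"
  using generate_field.m_inv[of x complex_ring "{w}"] K_0
  unfolding rat_adjoin_def by (cases "x = 0") simp_all

lemma K_divide: "x \<in> K \<Longrightarrow> y \<in> K \<Longrightarrow> x / y \<in> K"
  by (simp add: divide_inverse K_mult K_inverse)

lemma K_of_int: "of_int n \<in> K"
proof -
  have nat: "of_nat k \<in> K" for k by (induction k) (simp_all add: K_0 K_1 K_add)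
  show ?thesis using nat K_uminus[OF nat] by (cases n rule: int_cases2) simp_all
qed

lemma K_iff: "x \<in> K \<longleftrightarrow> (\<exists>r s. x = of_rat r + of_rat s * w)"
proof
  assume "x \<in> K"
  then show "\<exists>r s. x = of_rat r + of_rat s * w" unfolding rat_adjoin_def
  proof (induction rule: generate_field.induct)
    case one
    show ?case by (intro exI[of _ 1] exI[of _ 0]) simp
  next
    case (incl h)
    then show ?case by (intro exI[of _ 0] exI[of _ 1]) simp
  next
    case (a_inv h)
    then obtain r s where "h = of_rat r + of_rat s * w" by blast
    then show ?case by (intro exI[of _ "- r"] exI[of _ "- s"]) (simp add: of_rat_minus)
  next
    case (m_inv h)
    then obtain r s where h: "h = of_rat r + of_rat s * w" by blast
    define n where "n = r\<^sup>2 + of_int D * s\<^sup>2"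
    have mult: "h * (of_rat r - of_rat s * w) = of_rat n"
      by (simp add: h n_def of_rat_add of_rat_mult of_rat_power power2_eq_square algebra_simps w_square)
    have "of_rat r - of_rat s * w \<noteq> 0"
    proof
      \<comment> \<open>This element is the conjugate of \<open>h\<close>, so it vanishes only if
        \<open>h\<close> does; the irrationality of \<open>w\<close> is not invoked.\<close>
      assume *: "of_rat r - of_rat s * w = 0"
      have "cnj (of_rat q) = of_rat q" for q by (cases q) (simp add: of_rat_rat)
      then have "cnj (of_rat r - of_rat s * w) = h" by (simp add: h)
      then show False using * m_inv by simp
    qed
    then have "n \<noteq> 0" using mult m_inv by auto
    then have "h * ((of_rat r - of_rat s * w) / of_rat n) = 1" using mult by simp
    then have "inverse h = (of_rat r - of_rat s * w) / of_rat n" by (rule inverse_unique)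
    also have "\<dots> = of_rat (r / n) + of_rat (- s / n) * w"
      by (simp add: of_rat_divide of_rat_minus diff_divide_distrib)
    finally show ?case using m_inv by auto
  next
    case (eng_add h1 h2)
    then obtain r s r' s' where "h1 = of_rat r + of_rat s * w" "h2 = of_rat r' + of_rat s' * w" by blast
    then show ?case
      by (intro exI[of _ "r + r'"] exI[of _ "s + s'"]) (simp add: of_rat_add algebra_simps)
  next
    case (eng_mult h1 h2)
    then obtain r s r' s' where "h1 = of_rat r + of_rat s * w" "h2 = of_rat r' + of_rat s' * w" by blast
    then show ?case
      by (intro exI[of _ "r * r' - of_int D * s * s'"] exI[of _ "r * s' + s * r'"])
         (simp add: of_rat_add of_rat_diff of_rat_mult algebra_simps w_square)
  qed
next
  assume "\<exists>r s. x = of_rat r + of_rat s * w"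
  moreover have "of_rat q \<in> K" for q
    by (cases q) (auto simp: of_rat_rat intro: K_divide K_of_int)
  ultimately show "x \<in> K" by (auto intro: K_add K_mult K_w)
qed

lemma K_int_multiple:
  assumes "x \<in> K"
  obtains e a b :: int where "e > 0" "of_int e * x = of_int a + of_int b * w"
proof -
  obtain r s where x: "x = of_rat r + of_rat s * w" using assms K_iff by blast
  obtain a e where r: "r = Rat.Fract a e" "e > 0" by (cases r)
  obtain b f where s: "s = Rat.Fract b f" "f > 0" by (cases s)
  show ?thesis
    using r s by (intro that[of "e * f" "a * f" "b * e"]) (simp_all add: x of_rat_rat algebra_simps)
qed

text \<open>The root \<open>x\<close> of the integral quadratic \<open>f\<close> is an algebraic
  integer, so the primitive part of \<open>f\<close> has a unit as leading coefficient and
  \<open>e\<^sup>2\<close> divides every coefficient; that is, trace and norm of \<open>x\<close>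
  are integers. Hence \<open>e\<close> divides \<open>2 * a\<close>, by square-freeness also
  \<open>2 * b\<close>, and reduction modulo 4 removes the factor 2. The condition on
  \<open>b\<close> keeps \<open>x\<close> off the real line, where \<open>f\<close> would not be
  tied to the minimal polynomial.\<close>

lemma algebraic_int_coordinates:
  fixes a b e :: int
  assumes alg: "algebraic_int x" and x: "of_int e * x = of_int a + of_int b * w" and "e \<noteq> 0" "b \<noteq> 0"
  shows "e dvd a" "e dvd b"
proof -
  \<comment> \<open>Expansion of (e * x - a)^2 + D * b^2 = 0 in powers of \<open>x\<close>.\<close>
  define f where "f = [:a\<^sup>2 + D * b\<^sup>2, - 2 * a * e, e\<^sup>2:]"
  define c where "c = Polynomial.content f"
  have "of_int e * Im x = of_int b * sqrt (of_int D)" using arg_cong[OF x, of Im] by simp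
  then have "Im x \<noteq> 0" using assms(3,4) D_gt_1 by auto
  have "f \<noteq> 0" using assms(3) by (simp add: f_def)
  then have "c \<noteq> 0" by (simp add: c_def)
  have f_eq: "smult c (primitive_part f) = f" by (simp add: c_def)
  have "(of_int e * x - of_int a) * (of_int e * x - of_int a) = (of_int b * w) * (of_int b * w)"
    unfolding x by simp
  then have "poly (map_poly of_int f) x = 0"
    by (simp add: f_def map_poly_pCons power2_eq_square algebra_simps w_square)
  then have "poly (map_poly of_int (primitive_part f)) x = 0"
    using poly_of_int_hom(2)[of c "primitive_part f" x] \<open>c \<noteq> 0\<close> by (simp add: f_eq)
  moreover have "degree (primitive_part f) = 2"
    using degree_smult_eq[of c "primitive_part f"] \<open>c \<noteq> 0\<close> assms(3) by (simp only: f_eq) (simp add: f_def)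
  ultimately have "is_unit (lead_coeff (primitive_part f))"
    using alg \<open>Im x \<noteq> 0\<close> \<open>f \<noteq> 0\<close> by (intro primitive_quadratic_monic) simp_all
  moreover have "c * lead_coeff (primitive_part f) = e\<^sup>2"
    using lead_coeff_smult[of c "primitive_part f"] assms(3) by (simp only: f_eq) (simp add: f_def)
  ultimately have "e\<^sup>2 dvd c" by (metis dvd_refl mult_unit_dvd_iff)
  then have dvd: "e\<^sup>2 dvd coeff f i" for i by (metis c_def content_dvd_coeff dvd_trans)
  have norm_dvd: "e\<^sup>2 dvd a\<^sup>2 + D * b\<^sup>2" using dvd[of 0] by (simp add: f_def)
  have "e * e dvd (2 * a) * e" using dvd[of 1] by (simp add: f_def power2_eq_square)
  then have "e dvd 2 * a" using assms(3) by simp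
  then obtain t where t: "2 * a = e * t" ..
  have eq: "D * (2 * b)\<^sup>2 = 4 * (a\<^sup>2 + D * b\<^sup>2) - (2 * a)\<^sup>2" by (simp add: power2_eq_square algebra_simps)
  have "e\<^sup>2 dvd (2 * a)\<^sup>2" by (simp add: t power_mult_distrib)
  with norm_dvd have "e\<^sup>2 dvd D * (2 * b)\<^sup>2" unfolding eq by (intro dvd_diff dvd_mult)
  then have "e dvd 2 * b" by (rule squarefree_square_dvd_mult[OF squarefree_D _ assms(3)])
  then obtain u where u: "2 * b = e * u" ..
  obtain q where q: "a\<^sup>2 + D * b\<^sup>2 = e\<^sup>2 * q" using norm_dvd ..
  have "e\<^sup>2 * (t\<^sup>2 + D * u\<^sup>2) = (2 * a)\<^sup>2 + D * (2 * b)\<^sup>2"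
    unfolding t u by (simp add: power2_eq_square algebra_simps)
  also have "\<dots> = 4 * (a\<^sup>2 + D * b\<^sup>2)" by (simp add: power2_eq_square algebra_simps)
  also have "\<dots> = e\<^sup>2 * (4 * q)" by (simp add: q)
  finally have "t\<^sup>2 + D * u\<^sup>2 = 4 * q" using assms(3) by simp
  then have "4 dvd t\<^sup>2 + D * u\<^sup>2" by simp
  then have "even t" "even u" using sum_squares_dvd_4[OF D_mod_4] by blast+
  then show "e dvd a" "e dvd b" using t u by (auto elim!: evenE)
qed

lemma R_iff: "x \<in> R \<longleftrightarrow> (\<exists>a b :: int. x = of_int a + of_int b * w)"
proof
  assume "x \<in> R"
  then have x: "x \<in> K" "algebraic_int x" by (auto simp: ring_of_integers_def)
  obtain e a b where e: "e > 0" "of_int e * x = of_int a + of_int b * w"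
    using K_int_multiple[OF x(1)] .
  show "\<exists>a b :: int. x = of_int a + of_int b * w"
  \<comment> \<open>For \<open>b = 0\<close> the element is rational and the quadratic argument does
    not apply; a rational algebraic integer is an integer.\<close>
  proof (cases "b = 0")
    case True
    then have "x = of_int a / of_int e" using e by (simp add: field_simps)
    then have "x \<in> \<rat>" by simp
    then have "x \<in> \<int>" using x(2) rational_algebraic_int_is_int by blast
    then obtain k where "x = of_int k" by (elim Ints_cases)
    then show ?thesis by (intro exI[of _ k] exI[of _ 0]) simp
  next
    case False
    then have "e dvd a" "e dvd b" using algebraic_int_coordinates[OF x(2) e(2)] e(1) by auto
    then obtain a' b' where "a = e * a'" "b = e * b'" by (auto elim!: dvdE)
    then have "of_int e * x = of_int e * (of_int a' + of_int b' * w)" using e(2) by (simp add: algebra_simps)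
    then have "x = of_int a' + of_int b' * w" using e(1) by simp
    then show ?thesis by blast
  qed
next
  assume "\<exists>a b :: int. x = of_int a + of_int b * w"
  then obtain a b :: int where x: "x = of_int a + of_int b * w" by blast
  have "x + cnj x = of_int (2 * a)" "x * cnj x = of_int (a * a + D * b * b)"
    by (simp_all add: x algebra_simps w_square)
  then have "algebraic_int x" by (rule algebraic_int_quadratic)
  then show "x \<in> R" by (auto simp: ring_of_integers_def x intro: K_add K_mult K_of_int K_w)
qed

lemma R_subset_K: "R \<subseteq> K" by (auto simp: ring_of_integers_def)

lemma R_add: "x \<in> R \<Longrightarrow> y \<in> R \<Longrightarrow> x + y \<in> R"
proof -
  assume "x \<in> R" "y \<in> R"
  then obtain a b a' b' where "x = of_int a + of_int b * w" "y = of_int a' + of_int b' * w"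
    unfolding R_iff by blast
  then have "x + y = of_int (a + a') + of_int (b + b') * w" by (simp add: algebra_simps)
  then show ?thesis unfolding R_iff by blast
qed

lemma R_mult: "x \<in> R \<Longrightarrow> y \<in> R \<Longrightarrow> x * y \<in> R"
proof -
  assume "x \<in> R" "y \<in> R"
  then obtain a b a' b' where "x = of_int a + of_int b * w" "y = of_int a' + of_int b' * w"
    unfolding R_iff by blast
  then have "x * y = of_int (a * a' - D * b * b') + of_int (a * b' + b * a') * w"
    by (simp add: algebra_simps w_square)
  then show ?thesis unfolding R_iff by blast
qed

lemma R_of_int: "of_int n \<in> R" unfolding R_iff by (rule exI[of _ n], rule exI[of _ 0]) simp

lemma R_0: "0 \<in> R" and R_1: "1 \<in> R" using R_of_int[of 0] R_of_int[of 1] by simp_all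

lemma R_w: "w \<in> R" unfolding R_iff by (rule exI[of _ 0], rule exI[of _ 1]) simp

lemma R_cnj: "x \<in> R \<Longrightarrow> cnj x \<in> R"
  unfolding R_iff
proof safe
  fix a b show "\<exists>c d. cnj (of_int a + of_int b * w) = of_int c + of_int d * w"
    by (intro exI[of _ a] exI[of _ "- b"]) simp
qed

lemma R_real: "x \<in> R \<Longrightarrow> cnj x = x \<Longrightarrow> x \<in> \<int>"
proof -
  assume "x \<in> R" "cnj x = x"
  then obtain a b where x: "x = of_int a + of_int b * w" unfolding R_iff by blast
  have "of_int b * sqrt (of_int D) = 0" using arg_cong[OF \<open>cnj x = x\<close>, of Im] by (simp add: x)
  then have "b = 0" using D_gt_1 by simp
  then show ?thesis by (simp add: x)
qed

lemma R_norm_int: "x \<in> R \<Longrightarrow> x * cnj x \<in> \<int>"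
  by (intro R_real R_mult R_cnj) (simp_all add: mult.commute)

lemma R_trace_int: "x \<in> R \<Longrightarrow> x + cnj x \<in> \<int>"
  by (intro R_real R_add R_cnj) (simp_all add: add.commute)

lemma K_diff: "x \<in> K \<Longrightarrow> y \<in> K \<Longrightarrow> x - y \<in> K" using K_add[OF _ K_uminus, of x y] by simp

lemma K_cnj: "x \<in> K \<Longrightarrow> cnj x \<in> K"
proof -
  assume "x \<in> K"
  then obtain e a b where e: "e > 0" "of_int e * x = of_int a + of_int b * w" using K_int_multiple by blast
  then have "x = (of_int a + of_int b * w) / of_int e" by (simp add: field_simps)
  then have "cnj x = (of_int a - of_int b * w) / of_int e" by simp
  then show ?thesis by (simp add: K_divide K_diff K_mult K_of_int K_w)
qed

lemma K_denominator:
  assumes "x \<in> K"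
  obtains n :: int where "n > 0" "of_int n * x \<in> R"
  using K_int_multiple[OF assms] that by (metis R_iff)

section \<open>Fractional ideals and their products\<close>

lemma fractional_idealD:
  assumes "fractional_ideal K I"
  shows "x \<in> I \<Longrightarrow> x \<in> K" and "0 \<in> I" and "I \<noteq> {0}"
    and "x \<in> I \<Longrightarrow> y \<in> I \<Longrightarrow> x + y \<in> I"
    and "r \<in> R \<Longrightarrow> x \<in> I \<Longrightarrow> r * x \<in> I"
  using assms unfolding fractional_ideal_def by blast+

lemma fractional_ideal_denominator:
  assumes "fractional_ideal K I"
  obtains d where "d \<in> R" "d \<noteq> 0" "\<And>x. x \<in> I \<Longrightarrow> d * x \<in> R"
  using assms unfolding fractional_ideal_def by blast

lemma fractional_ideal_nonzero:
  assumes "fractional_ideal K I"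
  obtains x where "x \<in> I" "x \<noteq> 0"
proof -
  have "I \<noteq> {}" "I \<noteq> {0}" using fractional_idealD(2,3)[OF assms] by auto
  then show ?thesis using that by (metis subset_singletonD subsetI singletonI)
qed

lemma R_ideal_mult:
  assumes "fractional_ideal K I" shows "R \<star> I = I"
proof
  show "R \<star> I \<subseteq> I" by (rule ideal_mult_subset) (auto intro: fractional_idealD[OF assms])
  show "I \<subseteq> R \<star> I" using ideal_mult_prod[OF R_1] by force
qed

lemma fractional_ideal_principal:
  assumes "a \<in> K" "a \<noteq> 0" shows "fractional_ideal K ((*) a ` R)"
proof -
  obtain n :: int where n: "n > 0" "of_int n * a \<in> R" using K_denominator[OF assms(1)] .
  show ?thesis unfolding fractional_ideal_def
  proof (intro conjI)
    show "(*) a ` R \<subseteq> K" using assms(1) R_subset_K by (auto intro: K_mult)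
    show "0 \<in> (*) a ` R" using R_0 by force
    show "(*) a ` R \<noteq> {0}" using R_1 assms(2) by force
    show "\<forall>x\<in>(*) a ` R. \<forall>y\<in>(*) a ` R. x + y \<in> (*) a ` R"
      by (auto simp: distrib_left[symmetric] intro: R_add)
    show "\<forall>r\<in>R. \<forall>x\<in>(*) a ` R. r * x \<in> (*) a ` R"
      by (auto simp: mult.left_commute intro: R_mult)
    show "\<exists>d\<in>R. d \<noteq> 0 \<and> (\<forall>x\<in>(*) a ` R. d * x \<in> R)"
      using n by (intro bexI[of _ "of_int n"]) (auto simp: mult.assoc[symmetric] intro: R_mult R_of_int)
  qed
qed

lemma fractional_ideal_R: "fractional_ideal K R"
  using fractional_ideal_principal[OF K_1] by simp

lemma fractional_ideal_mult:
  assumes I: "fractional_ideal K I" and J: "fractional_ideal K J"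
  shows "fractional_ideal K (I \<star> J)"
proof -
  obtain d where d: "d \<in> R" "d \<noteq> 0" "\<And>x. x \<in> I \<Longrightarrow> d * x \<in> R" using fractional_ideal_denominator[OF I] by blast
  obtain e where e: "e \<in> R" "e \<noteq> 0" "\<And>x. x \<in> J \<Longrightarrow> e * x \<in> R" using fractional_ideal_denominator[OF J] by blast
  show ?thesis unfolding fractional_ideal_def
  proof (intro conjI)
    show "I \<star> J \<subseteq> K"
      by (rule ideal_mult_subset) (auto intro: K_add K_mult fractional_idealD(1)[OF I] fractional_idealD(1)[OF J])
    show "0 \<in> I \<star> J" using ideal_mult_prod[OF fractional_idealD(2)[OF I] fractional_idealD(2)[OF J]] by simp
    show "I \<star> J \<noteq> {0}"
    proof
      assume *: "I \<star> J = {0}"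
      obtain x where x: "x \<in> I" "x \<noteq> 0" by (rule fractional_ideal_nonzero[OF I])
      obtain y where y: "y \<in> J" "y \<noteq> 0" by (rule fractional_ideal_nonzero[OF J])
      have "x * y \<in> {0}" using ideal_mult_prod[OF x(1) y(1)] unfolding * .
      then show False using x(2) y(2) by simp
    qed
    show "\<forall>x\<in>I \<star> J. \<forall>y\<in>I \<star> J. x + y \<in> I \<star> J" by (intro ballI ideal_mult_sum)
    show "\<forall>r\<in>R. \<forall>x\<in>I \<star> J. r * x \<in> I \<star> J"
      by (intro ballI ideal_mult_closed fractional_idealD(5)[OF I])
    have "d * e * x \<in> R" if "x \<in> I \<star> J" for x
      using that
    proof (induction rule: ideal_mult_induct)
      case (prod i j)
      have "d * e * (i * j) = (d * i) * (e * j)" by simp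
      then show ?case using d(3)[OF prod(1)] e(3)[OF prod(2)] by (simp only: R_mult)
    qed (simp add: distrib_left R_add)
    then show "\<exists>d\<in>R. d \<noteq> 0 \<and> (\<forall>x\<in>I \<star> J. d * x \<in> R)"
      using d(1,2) e(1,2) by (intro bexI[of _ "d * e"]) (auto intro: R_mult)
  qed
qed

lemma principal_mult:
  assumes "fractional_ideal K I" shows "((*) a ` R) \<star> I = (*) a ` I"
  by (simp add: ideal_mult_scale R_ideal_mult assms)

lemma fractional_ideal_scale:
  assumes "fractional_ideal K I" "a \<in> K" "a \<noteq> 0"
  shows "fractional_ideal K ((*) a ` I)"
  using fractional_ideal_mult[OF fractional_ideal_principal[OF assms(2,3)] assms(1)]
  by (simp add: principal_mult assms(1))

section \<open>The ideal class group\<close>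

lemma fractional_ideal_int_combination:
  assumes "fractional_ideal K I" "x \<in> I" "y \<in> I"
  shows "of_int i * x + of_int j * y \<in> I"
  by (intro fractional_idealD(4,5)[OF assms(1)] R_of_int assms(2,3))

lemma fractional_ideal_diff:
  assumes "fractional_ideal K I" "x \<in> I" "y \<in> I"
  shows "x - y \<in> I"
  using fractional_ideal_int_combination[OF assms, of 1 "-1"] by simp

text \<open>A triangular basis in the manner of the Hermite normal form: \<open>n\<close> generates
  the rational integers in \<open>I\<close>, \<open>g\<close> generates the
  \<open>w\<close>-coordinates occurring in \<open>I\<close>, and \<open>c\<close> completes
  \<open>g\<close> to an element of \<open>I\<close>. Subtracting a multiple of the latter from
  \<open>z\<close> leaves a rational integer in \<open>I\<close>.\<close>

lemma integral_ideal_basis: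
  assumes I: "fractional_ideal K I" "I \<subseteq> R"
  obtains x y where "x \<in> I" "y \<in> I" "\<And>z. z \<in> I \<Longrightarrow> \<exists>i j :: int. z = of_int i * x + of_int j * y"
proof -
  note diff = fractional_ideal_diff[OF I(1)]
  have zero: "0 \<in> I" by (rule fractional_idealD(2)[OF I(1)])
  obtain n where n: "{a. of_int a \<in> I} = range ((*) n)"
  proof (rule int_subgroup_principal)
    show "0 \<in> {a. of_int a \<in> I}" using zero by simp
    show "x - y \<in> {a. of_int a \<in> I}" if "x \<in> {a. of_int a \<in> I}" "y \<in> {a. of_int a \<in> I}" for x y
      using that diff[of "of_int x" "of_int y"] by simp
  qed
  obtain g where g: "{b. \<exists>a. of_int a + of_int b * w \<in> I} = range ((*) g)"
  proof (rule int_subgroup_principal)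
    show "0 \<in> {b. \<exists>a. of_int a + of_int b * w \<in> I}" using zero by (auto intro: exI[of _ 0])
    fix x y assume "x \<in> {b. \<exists>a. of_int a + of_int b * w \<in> I}" "y \<in> {b. \<exists>a. of_int a + of_int b * w \<in> I}"
    then obtain a b where "of_int a + of_int x * w \<in> I" "of_int b + of_int y * w \<in> I" by blast
    from diff[OF this] have "of_int (a - b) + of_int (x - y) * w \<in> I" by (simp add: algebra_simps)
    then show "x - y \<in> {b. \<exists>a. of_int a + of_int b * w \<in> I}" by blast
  qed
  have "n \<in> {a. of_int a \<in> I}" unfolding n by (rule range_eqI[of _ _ 1]) simp
  then have n_I: "of_int n \<in> I" by simp
  have "g \<in> {b. \<exists>a. of_int a + of_int b * w \<in> I}" unfolding g by (rule range_eqI[of _ _ 1]) simp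
  then obtain c where c_I: "of_int c + of_int g * w \<in> I" by blast
  have "\<exists>i j :: int. z = of_int i * of_int n + of_int j * (of_int c + of_int g * w)" if z: "z \<in> I" for z
  proof -
    obtain a b where ab: "z = of_int a + of_int b * w" using z I(2) R_iff by blast
    then have "b \<in> range ((*) g)" using z unfolding g[symmetric] by blast
    then obtain j where j: "b = g * j" by blast
    have "of_int (a - j * c) \<in> I"
      using fractional_ideal_int_combination[OF I(1) z c_I, of 1 "- j"] by (simp add: ab j algebra_simps)
    then have "a - j * c \<in> range ((*) n)" unfolding n[symmetric] by blast
    then obtain i where "a - j * c = n * i" by blast
    then have "a = n * i + j * c" by simp
    then have "z = of_int i * of_int n + of_int j * (of_int c + of_int g * w)"
      by (simp add: ab j algebra_simps)
    then show ?thesis by blast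
  qed
  with n_I c_I show thesis by (rule that)
qed

lemma fractional_ideal_cnj:
  assumes "fractional_ideal K I" shows "fractional_ideal K (cnj ` I)"
proof -
  note I = fractional_idealD[OF assms]
  obtain d where d: "d \<in> R" "d \<noteq> 0" "\<And>x. x \<in> I \<Longrightarrow> d * x \<in> R"
    using fractional_ideal_denominator[OF assms] by blast
  obtain x where x: "x \<in> I" "x \<noteq> 0" by (rule fractional_ideal_nonzero[OF assms])
  show ?thesis unfolding fractional_ideal_def
  proof (intro conjI)
    show "cnj ` I \<subseteq> K" by (auto intro: K_cnj I(1))
    show "0 \<in> cnj ` I" using I(2) by force
    show "cnj ` I \<noteq> {0}" using x by force
    show "\<forall>x\<in>cnj ` I. \<forall>y\<in>cnj ` I. x + y \<in> cnj ` I"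
      using I(4) by (auto simp flip: complex_cnj_add)
    show "\<forall>r\<in>R. \<forall>x\<in>cnj ` I. r * x \<in> cnj ` I"
    proof (safe)
      fix r x assume "r \<in> R" "x \<in> I"
      then have "cnj r * x \<in> I" by (intro I(5) R_cnj)
      then show "r * cnj x \<in> cnj ` I" by (rule rev_image_eqI) simp
    qed
    show "\<exists>d\<in>R. d \<noteq> 0 \<and> (\<forall>x\<in>cnj ` I. d * x \<in> R)"
      using d R_cnj[OF d(3)] by (intro bexI[of _ "cnj d"]) (auto intro: R_cnj)
  qed
qed

text \<open>Hurwitz's argument: if \<open>I\<close> is generated by \<open>x\<close> and \<open>y\<close> and \<open>g\<close> is the gcd of the norms of
  \<open>x\<close> and \<open>y\<close> and the trace of \<open>z = x * cnj y\<close>, then \<open>z / g\<close> has integral trace and norm, so it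
  lies in the maximal order.\<close>

lemma integral_ideal_mult_cnj:
  assumes I: "fractional_ideal K I" "I \<subseteq> R"
  obtains g :: int where "g \<noteq> 0" "I \<star> cnj ` I = (*) (of_int g) ` R"
proof -
  obtain x y where xy: "x \<in> I" "y \<in> I"
    and basis: "\<And>z. z \<in> I \<Longrightarrow> \<exists>i j :: int. z = of_int i * x + of_int j * y"
    by (rule integral_ideal_basis[OF I]) blast
  have xyR: "x \<in> R" "y \<in> R" using xy I(2) by auto
  define u where "u = x * cnj y"
  have "u \<in> R" unfolding u_def by (intro R_mult R_cnj xyR)
  obtain n1 where n1: "x * cnj x = of_int n1" using R_norm_int[OF xyR(1)] by (elim Ints_cases)
  obtain n2 where n2: "y * cnj y = of_int n2" using R_norm_int[OF xyR(2)] by (elim Ints_cases)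
  obtain t where t: "u + cnj u = of_int t" using R_trace_int[OF \<open>u \<in> R\<close>] by (elim Ints_cases)
  define g where "g = gcd (gcd n1 n2) t"
  have "g \<noteq> 0"
  proof
    assume "g = 0"
    then have "x = 0" "y = 0" using n1 n2 by (simp_all add: g_def)
    then have "z = 0" if "z \<in> I" for z using basis[OF that] by auto
    then show False using fractional_ideal_nonzero[OF I(1)] by blast
  qed
  have "g dvd n1" "g dvd n2" "g dvd t" by (auto simp: g_def intro: dvd_trans)
  then obtain m1 m2 s where m: "n1 = g * m1" "n2 = g * m2" "t = g * s" by (auto elim!: dvdE)
  define v where "v = u / of_int g"
  have u: "u = of_int g * v" using \<open>g \<noteq> 0\<close> by (simp add: v_def)
  have "u * cnj u = (x * cnj x) * (y * cnj y)" by (simp add: u_def)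
  also have "\<dots> = of_int (g * m1) * of_int (g * m2)" by (simp add: n1 n2 m)
  finally have "v * cnj v = of_int (m1 * m2)" using \<open>g \<noteq> 0\<close> by (simp add: u)
  moreover have "of_int g * (v + cnj v) = of_int g * of_int s" using t by (simp add: u m distrib_left)
  then have "v + cnj v = of_int s" using \<open>g \<noteq> 0\<close> by simp
  ultimately have "algebraic_int v" by (intro algebraic_int_quadratic)
  moreover have "v \<in> K" using \<open>u \<in> R\<close> R_subset_K by (auto simp: v_def intro: K_divide K_of_int)
  ultimately have "v \<in> R" by (simp add: ring_of_integers_def)
  have IJ: "fractional_ideal K (I \<star> cnj ` I)" by (rule fractional_ideal_mult[OF I(1) fractional_ideal_cnj[OF I(1)]])
  have prod: "a * cnj b \<in> I \<star> cnj ` I" if "a \<in> I" "b \<in> I" for a b using that by (intro ideal_mult_prod) auto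
  have "I \<star> cnj ` I = (*) (of_int g) ` R"
  proof
    show "I \<star> cnj ` I \<subseteq> (*) (of_int g) ` R"
    proof (rule ideal_mult_subset)
      fix a b assume "a \<in> I" "b \<in> cnj ` I"
      then obtain b' where b': "b = cnj b'" "b' \<in> I" by blast
      obtain i j where a: "a = of_int i * x + of_int j * y" using basis[OF \<open>a \<in> I\<close>] by blast
      obtain k l where b: "b' = of_int k * x + of_int l * y" using basis[OF b'(2)] by blast
      have "a * b = of_int (i * k) * (x * cnj x) + of_int (j * l) * (y * cnj y)
          + of_int (i * l) * u + of_int (j * k) * cnj u"
        by (simp add: a b b'(1) u_def algebra_simps)
      also have "\<dots> = of_int g * (of_int (i * k * m1 + j * l * m2) + of_int (i * l) * v + of_int (j * k) * cnj v)"
        by (simp add: n1 n2 u m algebra_simps)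
      finally show "a * b \<in> (*) (of_int g) ` R"
        using \<open>v \<in> R\<close> by (auto intro!: imageI R_add R_mult R_of_int R_cnj)
    next
      fix a b assume "a \<in> (*) (of_int g) ` R" "b \<in> (*) (of_int g) ` R"
      then show "a + b \<in> (*) (of_int g) ` R" by (auto simp: distrib_left[symmetric] intro: R_add)
    qed
    have gcd_mem: "of_int (gcd a b) \<in> I \<star> cnj ` I" if "of_int a \<in> I \<star> cnj ` I" "of_int b \<in> I \<star> cnj ` I" for a b :: int
    proof -
      obtain i j where "i * a + j * b = gcd a b" using bezout_int by blast
      then have "of_int (gcd a b) = (of_int i * of_int a + of_int j * of_int b :: complex)"
        by (metis of_int_add of_int_mult)
      then show ?thesis using fractional_ideal_int_combination[OF IJ that] by simp
    qed
    have "of_int n1 \<in> I \<star> cnj ` I" "of_int n2 \<in> I \<star> cnj ` I"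
      using prod[OF xy(1,1)] prod[OF xy(2,2)] by (simp_all add: n1 n2)
    then have "of_int (gcd n1 n2) \<in> I \<star> cnj ` I"
      by (rule gcd_mem)
    moreover have "of_int t \<in> I \<star> cnj ` I"
      using ideal_mult_sum[OF prod[OF xy] prod[OF xy(2,1)]] t by (simp add: u_def mult.commute)
    ultimately have "of_int g \<in> I \<star> cnj ` I"
      unfolding g_def by (rule gcd_mem)
    then show "(*) (of_int g) ` R \<subseteq> I \<star> cnj ` I"
      using fractional_idealD(5)[OF IJ] by (auto simp: mult.commute)
  qed
  with \<open>g \<noteq> 0\<close> show thesis by (rule that)
qed

text \<open>Clearing denominators gives an integral ideal \<open>A = d * I\<close> whose product
  with its conjugate is generated by an integer \<open>g\<close>. Dividing by \<open>g\<close> and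
  moving \<open>d\<close> to the other factor exhibits the inverse of \<open>I\<close> as a multiple
  of the conjugate of \<open>A\<close>.\<close>

lemma fractional_ideal_inverse:
  assumes I: "fractional_ideal K I"
  obtains J where "fractional_ideal K J" "J \<star> I = R"
proof -
  obtain d where d: "d \<in> R" "d \<noteq> 0" "\<And>x. x \<in> I \<Longrightarrow> d * x \<in> R"
    using fractional_ideal_denominator[OF I] by blast
  define A where "A = (*) d ` I"
  have A: "fractional_ideal K A" "A \<subseteq> R"
    using fractional_ideal_scale[OF I _ d(2)] d(1,3) R_subset_K by (auto simp: A_def)
  obtain g :: int where g: "g \<noteq> 0" "A \<star> cnj ` A = (*) (of_int g) ` R"
    by (rule integral_ideal_mult_cnj[OF A])
  define J where "J = (*) (d / of_int g) ` cnj ` A"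
  have "d \<in> K" using d(1) R_subset_K by blast
  then have "d / of_int g \<in> K" by (intro K_divide K_of_int)
  then have "fractional_ideal K J"
    unfolding J_def using d(2) g(1) by (intro fractional_ideal_scale fractional_ideal_cnj A) simp_all
  moreover have "J \<star> I = R"
  proof -
    have "J \<star> I = (*) (d / of_int g) ` (cnj ` A \<star> I)"
      unfolding J_def by (rule ideal_mult_scale)
    also have "\<dots> = (*) (1 / of_int g) ` (*) d ` (cnj ` A \<star> I)"
      unfolding scale_scale by simp
    also have "(*) d ` (cnj ` A \<star> I) = A \<star> cnj ` A"
      unfolding A_def[symmetric] by (simp add: ideal_mult_commute[of _ I] ideal_mult_scale[symmetric] A_def[symmetric])
    finally show ?thesis unfolding g(2) scale_scale using g(1) by simp
  qed
  ultimately show thesis by (rule that)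
qed

section \<open>The group of fractional ideals and its principal subgroup\<close>

abbreviation "G \<equiv> fractional_ideal_group K"
abbreviation "H \<equiv> principal_fractional_ideals K"

lemma G_simps [simp]:
  "carrier G = {I. fractional_ideal K I}" "I \<otimes>\<^bsub>G\<^esub> J = I \<star> J" "\<one>\<^bsub>G\<^esub> = R"
  by (simp_all add: fractional_ideal_group_def)

lemma comm_group_G: "comm_group G"
proof (rule comm_groupI)
  show "I \<otimes>\<^bsub>G\<^esub> J = J \<otimes>\<^bsub>G\<^esub> I" for I J by (simp add: ideal_mult_commute[of I])
  show "\<exists>J\<in>carrier G. J \<otimes>\<^bsub>G\<^esub> I = \<one>\<^bsub>G\<^esub>" if I: "I \<in> carrier G" for I
  proof -
    have "fractional_ideal K I" using I by simp
    then obtain J where "fractional_ideal K J" "J \<star> I = R" by (rule fractional_ideal_inverse)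
    then show ?thesis by (intro bexI[of _ J]) simp_all
  qed
qed (simp_all add: fractional_ideal_R fractional_ideal_mult ideal_mult_assoc R_ideal_mult)

interpretation G: comm_group G by (rule comm_group_G)

text \<open>Stated for arbitrary complex \<open>a\<close> and \<open>b\<close>, so that the
  induction for powers carries no side conditions.\<close>

lemma principal_mult_principal: "((*) a ` R) \<star> ((*) b ` R) = (*) (a * b) ` R"
proof -
  have "R \<star> ((*) b ` R) = (*) b ` R"
    unfolding ideal_mult_commute[of R "(*) b ` R"] ideal_mult_scale
    by (simp only: R_ideal_mult fractional_ideal_R)
  then show ?thesis by (simp only: ideal_mult_scale scale_scale)
qed

lemma principal_pow: "((*) a ` R) [^]\<^bsub>G\<^esub> (n :: nat) = (*) (a ^ n) ` R"
  by (induction n) (simp_all add: principal_mult_principal power_Suc2 del: power_Suc)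

lemma H_iff: "I \<in> H \<longleftrightarrow> (\<exists>a\<in>K. a \<noteq> 0 \<and> I = (*) a ` R)"
  unfolding principal_fractional_ideals_def by blast

lemma principal_subgroup: "subgroup H G"
proof (rule G.subgroupI)
  show "H \<subseteq> carrier G"
  proof
    fix I assume "I \<in> H"
    then obtain a where "a \<in> K" "a \<noteq> 0" "I = (*) a ` R" unfolding H_iff by blast
    then show "I \<in> carrier G" using fractional_ideal_principal by simp
  qed
  have "(*) 1 ` R \<in> H" unfolding H_iff using K_1 by (intro bexI[of _ 1]) simp_all
  then show "H \<noteq> {}" by (metis empty_iff)
next
  fix I assume "I \<in> H"
  then obtain a where a: "a \<in> K" "a \<noteq> 0" "I = (*) a ` R" unfolding H_iff by blast
  have "inv\<^bsub>G\<^esub> I = (*) (inverse a) ` R"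
    using a by (intro G.inv_equality) (simp_all add: principal_mult_principal fractional_ideal_principal K_inverse)
  then show "inv\<^bsub>G\<^esub> I \<in> H"
    unfolding H_iff using K_inverse[OF a(1)] a(2) by (intro bexI[of _ "inverse a"]) simp_all
next
  fix I J assume "I \<in> H" "J \<in> H"
  then obtain a b where ab: "a \<in> K" "a \<noteq> 0" "I = (*) a ` R" "b \<in> K" "b \<noteq> 0" "J = (*) b ` R"
    unfolding H_iff by blast
  have "I \<otimes>\<^bsub>G\<^esub> J = (*) (a * b) ` R" by (simp add: ab principal_mult_principal)
  then show "I \<otimes>\<^bsub>G\<^esub> J \<in> H"
    unfolding H_iff using K_mult[OF ab(1,4)] ab(2,5) by (intro bexI[of _ "a * b"]) simp_all
qed

interpretation N: normal H G
  by (rule G.subgroup_imp_normal[OF principal_subgroup])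

section \<open>Finiteness of the class group\<close>

text \<open>A substitute for division with remainder, which fails in \<open>R\<close> in general: a
  small multiplier \<open>t\<close> is allowed. Dirichlet's theorem makes the
  \<open>w\<close>-coordinate of \<open>t * x\<close> differ from an integer by less than
  \<open>1 / D\<close>, and the real part is simply rounded. The squared distance is then at most
  1/4 + 1/D, and \<open>D \<ge> 2\<close> keeps it below 1.\<close>

lemma K_approx:
  obtains t :: int and y where "0 < t" "t \<le> D" "y \<in> R" "cmod (of_int t * x - y) < 1"
proof -
  have D: "real_of_int D \<ge> 2" "sqrt D > 0" using D_gt_1 by simp_all
  define \<theta> where "\<theta> = Im x / sqrt D"
  have "nat D > 0" using D_gt_1 by simp
  then obtain h t where t: "0 < t" "t \<le> int (nat D)" "\<bar>of_int t * \<theta> - of_int h\<bar> < 1 / real (nat D)"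
    by (rule Dirichlet_approx)
  define y where "y = of_int (round (t * Re x)) + of_int h * w"
  define z where "z = of_int t * x - y"
  have "y \<in> R" unfolding y_def R_iff by blast
  have "\<bar>Re z\<bar> \<le> 1 / 2"
    using of_int_round_abs_le[of "t * Re x"] by (simp add: z_def y_def abs_minus_commute)
  then have re: "(Re z)\<^sup>2 \<le> (1 / 2)\<^sup>2" by (simp only: abs_le_square_iff[symmetric] abs_divide)
  have "Im z = sqrt D * (of_int t * \<theta> - of_int h)"
    using D(2) by (simp add: z_def y_def \<theta>_def algebra_simps)
  then have "(Im z)\<^sup>2 = D * \<bar>of_int t * \<theta> - of_int h\<bar>\<^sup>2"
    using D(1) by (simp add: power_mult_distrib)
  also have "\<dots> \<le> D * (1 / D)\<^sup>2"
    using t(3) D by (intro mult_left_mono power_mono) simp_all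
  also have "\<dots> \<le> 1 / 2" using D by (simp add: power2_eq_square field_simps)
  finally have "(cmod z)\<^sup>2 < 1\<^sup>2" using re unfolding cmod_power2 by (simp add: power_divide)
  then have "cmod z < 1" by (rule power_less_imp_less_base) simp
  then show thesis using t D_gt_1 \<open>y \<in> R\<close> by (intro that[of t y]) (simp_all add: z_def)
qed

lemma R_cmod_square: "x \<in> R \<Longrightarrow> \<exists>n :: nat. (cmod x)\<^sup>2 = real n"
proof -
  assume "x \<in> R"
  then obtain k where k: "x * cnj x = of_int k" using R_norm_int by (auto elim: Ints_cases)
  then have "complex_of_real ((cmod x)\<^sup>2) = of_real (of_int k)" using complex_norm_square[of x] by simp
  then have k': "(cmod x)\<^sup>2 = of_int k" by (simp only: of_real_eq_iff)
  then have "k \<ge> 0" by (metis of_int_0_le_iff zero_le_power2)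
  then show ?thesis using k' by (intro exI[of _ "nat k"]) simp
qed

lemma min_norm_element:
  assumes I: "fractional_ideal K I" "I \<subseteq> R"
  obtains b where "b \<in> I" "b \<noteq> 0" "\<And>z. z \<in> I \<Longrightarrow> cmod z < cmod b \<Longrightarrow> z = 0"
proof -
  define f where "f = (\<lambda>x. nat \<lfloor>(cmod x)\<^sup>2\<rfloor>)"
  have f: "real (f x) = (cmod x)\<^sup>2" if x: "x \<in> I" for x
  proof -
    obtain n where "(cmod x)\<^sup>2 = real n" using R_cmod_square[of x] x I(2) by blast
    then show ?thesis by (simp add: f_def)
  qed
  obtain x where "x \<in> I" "x \<noteq> 0" by (rule fractional_ideal_nonzero[OF I(1)])
  then obtain b where b: "b \<in> I \<and> b \<noteq> 0" "\<And>z. z \<in> I \<and> z \<noteq> 0 \<Longrightarrow> f b \<le> f z"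
    using ex_has_least_nat[of "\<lambda>x. x \<in> I \<and> x \<noteq> 0" x f] by blast
  have "z = 0" if z: "z \<in> I" "cmod z < cmod b" for z
  proof (rule ccontr)
    assume "z \<noteq> 0"
    then have "f b \<le> f z" using b(2) z(1) by blast
    then have "(cmod b)\<^sup>2 \<le> (cmod z)\<^sup>2" using f b(1) z(1) by (metis of_nat_le_iff)
    then show False using z(2) by (simp add: power2_le_iff_abs_le)
  qed
  with b(1) show thesis by (intro that) blast+
qed

text \<open>A common multiple of all multipliers \<open>t\<close> that the approximation may return,
  so that one constant serves every element of every ideal.\<close>

definition reduction_bound :: int where "reduction_bound = fact (nat D)"

lemma reduction_bound_pos: "reduction_bound > 0"
  by (simp add: reduction_bound_def)

text \<open>Let \<open>b\<close> be a nonzero element of least norm in an integral ideal \<open>A\<close>. For \<open>a \<in> A\<close> some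
  multiple \<open>t * (a / b)\<close> with \<open>t \<le> D\<close> lies at distance less than 1 from some \<open>y\<close> in \<open>R\<close>, which
  forces \<open>t * a = y * b\<close>. Thus \<open>D! / b\<close> maps \<open>A\<close> into \<open>R\<close>.\<close>

lemma ideal_class_bounded_representative:
  assumes I: "fractional_ideal K I"
  obtains P J where "P \<in> H" "fractional_ideal K J" "J \<subseteq> R" "of_int reduction_bound \<in> J" "I = P \<star> J"
proof -
  let ?M = "complex_of_int reduction_bound"
  obtain d where d: "d \<in> R" "d \<noteq> 0" "\<And>x. x \<in> I \<Longrightarrow> d * x \<in> R"
    using fractional_ideal_denominator[OF I] by blast
  have "d \<in> K" using d(1) R_subset_K by blast
  define A where "A = (*) d ` I"
  have A: "fractional_ideal K A" "A \<subseteq> R"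
    using fractional_ideal_scale[OF I \<open>d \<in> K\<close> d(2)] d(3) by (auto simp: A_def)
  obtain b where b: "b \<in> A" "b \<noteq> 0" "\<And>z. z \<in> A \<Longrightarrow> cmod z < cmod b \<Longrightarrow> z = 0"
    by (rule min_norm_element[OF A]) blast
  have "b \<in> K" using b(1) A(2) R_subset_K by blast
  have M: "?M \<noteq> 0" using reduction_bound_pos by simp
  define J where "J = (*) (?M / b) ` A"
  have "fractional_ideal K J"
    unfolding J_def using b(2) M \<open>b \<in> K\<close> by (intro fractional_ideal_scale A K_divide K_of_int) simp_all
  moreover have "J \<subseteq> R"
  proof
    fix z assume "z \<in> J"
    then obtain a where a: "a \<in> A" "z = ?M / b * a" unfolding J_def by blast
    obtain t :: int and y where t: "0 < t" "t \<le> D" "y \<in> R" "cmod (of_int t * (a / b) - y) < 1"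
      by (rule K_approx)
    define c where "c = of_int t * a - y * b"
    have "c \<in> A"
      unfolding c_def by (intro fractional_ideal_diff[OF A(1)] fractional_idealD(5)[OF A(1)] R_of_int a(1) b(1) t(3))
    have "c = (of_int t * (a / b) - y) * b" using b(2) by (simp add: c_def field_simps)
    then have "cmod c = cmod (of_int t * (a / b) - y) * cmod b" by (simp only: norm_mult)
    also have "\<dots> < 1 * cmod b" using t(4) b(2) by (intro mult_strict_right_mono) simp_all
    finally have "c = 0" using b(3)[OF \<open>c \<in> A\<close>] by simp
    then have ab: "of_int t * a = y * b" by (simp add: c_def)
    have "nat t dvd fact (nat D)" using t(1,2) by (intro dvd_fact) simp_all
    then have "int (nat t) dvd fact (nat D)" by (metis int_dvd_int_iff of_nat_fact)
    then obtain s where s: "reduction_bound = t * s" using t(1) by (auto simp: reduction_bound_def)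
    have "z = of_int s * (of_int t * a) / b" by (simp add: a s)
    also have "\<dots> = of_int s * y" using b(2) by (simp add: ab)
    finally show "z \<in> R" using t(3) by (simp add: R_mult R_of_int)
  qed
  moreover have "?M \<in> J" unfolding J_def using b(1,2) by (intro image_eqI[of _ _ b]) simp_all
  moreover have "(*) (b / (?M * d)) ` R \<in> H"
    unfolding H_iff using b(2) M d(2) \<open>b \<in> K\<close> \<open>d \<in> K\<close>
    by (intro bexI[of _ "b / (?M * d)"] K_divide K_mult K_of_int) simp_all
  moreover have "I = ((*) (b / (?M * d)) ` R) \<star> J"
  proof -
    have "((*) (b / (?M * d)) ` R) \<star> J = (*) (b / (?M * d)) ` J"
      by (rule principal_mult) fact
    also have "\<dots> = (*) (b / (?M * d) * (?M / b * d)) ` I"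
      unfolding J_def A_def scale_scale ..
    also have "b / (?M * d) * (?M / b * d) = 1" using b(2) M d(2) by simp
    finally show ?thesis by simp
  qed
  ultimately show thesis by (intro that)
qed

text \<open>An ideal containing \<open>M\<close> contains \<open>M * R\<close>, so it is a union of
  residue classes modulo \<open>M\<close>. The finite set \<open>B\<close> represents these classes,
  and \<open>J\<close> is recovered from its trace on \<open>B\<close>.\<close>

lemma finite_integral_ideals_containing:
  fixes M :: int
  assumes "M > 0"
  shows "finite {J. fractional_ideal K J \<and> J \<subseteq> R \<and> of_int M \<in> J}" (is "finite ?S")
proof -
  define B where "B = (\<lambda>(a, b). of_int a + of_int b * w) ` ({0..<M} \<times> {0..<M})"
  have "finite B" by (simp add: B_def)
  have subset: "J \<subseteq> J'" if J: "J \<in> ?S" and J': "J' \<in> ?S" and eq: "J \<inter> B = J' \<inter> B" for J J'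
  proof
    fix z assume "z \<in> J"
    then have "z \<in> R" using J by blast
    then obtain a b where z: "z = of_int a + of_int b * w" unfolding R_iff by blast
    define y where "y = of_int (a div M) + of_int (b div M) * w"
    define z' where "z' = of_int (a mod M) + of_int (b mod M) * w"
    have "y \<in> R" unfolding y_def R_iff by blast
    have z_eq: "z = z' + y * of_int M"
    proof -
      have "complex_of_int k = of_int (k mod M) + of_int (k div M) * of_int M" for k
        by (metis mod_div_mult_eq of_int_add of_int_mult)
      from this[of a] this[of b] show ?thesis
        unfolding z z'_def y_def by (simp add: algebra_simps)
    qed
    have "z' \<in> B" using assms by (auto simp: B_def z'_def)
    have "z - y * of_int M \<in> J"
      using J \<open>z \<in> J\<close> \<open>y \<in> R\<close> by (intro fractional_ideal_diff fractional_idealD(5)) auto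
    then have "z' \<in> J' " using \<open>z' \<in> B\<close> eq by (auto simp: z_eq)
    then show "z \<in> J'"
      unfolding z_eq using J' \<open>y \<in> R\<close> by (intro fractional_idealD(4,5)) auto
  qed
  have "inj_on (\<lambda>J. J \<inter> B) ?S"
  proof (rule inj_onI)
    fix J J' assume "J \<in> ?S" "J' \<in> ?S" "J \<inter> B = J' \<inter> B"
    then show "J = J'" using subset[of J J'] subset[of J' J] by (intro subset_antisym) metis+
  qed
  moreover have "finite ((\<lambda>J. J \<inter> B) ` ?S)"
  proof (rule finite_subset)
    show "(\<lambda>J. J \<inter> B) ` ?S \<subseteq> Pow B" by (rule image_subsetI) simp
    show "finite (Pow B)" using \<open>finite B\<close> by simp
  qed
  ultimately show ?thesis by (rule finite_imageD[rotated])
qed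

text \<open>The principal factor of the bounded representation is absorbed by \<open>H\<close>, so
  each class is represented by one of finitely many integral ideals.\<close>

lemma finite_class_group: "finite (carrier (ideal_class_group K))"
proof -
  let ?S = "{J. fractional_ideal K J \<and> J \<subseteq> R \<and> of_int reduction_bound \<in> J}"
  have "carrier (ideal_class_group K) \<subseteq> (\<lambda>J. H #>\<^bsub>G\<^esub> J) ` ?S"
  proof
    fix C assume "C \<in> carrier (ideal_class_group K)"
    then obtain I where I: "I \<in> carrier G" "C = H #>\<^bsub>G\<^esub> I"
      unfolding ideal_class_group_def carrier_FactGroup by blast
    then have "fractional_ideal K I" by simp
    then obtain P J where J: "P \<in> H" "fractional_ideal K J" "J \<subseteq> R" "of_int reduction_bound \<in> J" "I = P \<star> J"
      by (rule ideal_class_bounded_representative)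
    have PJ: "P \<in> carrier G" "J \<in> carrier G" using J(1,2) N.subset by auto
    have "C = H #>\<^bsub>G\<^esub> P #>\<^bsub>G\<^esub> J" using G.coset_mult_assoc[OF N.subset PJ] by (simp add: I(2) J(5))
    also have "H #>\<^bsub>G\<^esub> P = H" using J(1) PJ(1) N.subgroup_axioms by (intro G.coset_join2)
    finally show "C \<in> (\<lambda>J. H #>\<^bsub>G\<^esub> J) ` ?S" using J by blast
  qed
  then show ?thesis
    using finite_integral_ideals_containing[OF reduction_bound_pos] finite_surj by blast
qed

text \<open>The order of the class of \<open>I\<close> divides the prime \<open>p\<close> and is not
  1, so it equals \<open>p\<close>; Lagrange's theorem for the finite or infinite class group
  concludes.\<close>

lemma class_number_dvd:
  assumes "prime p" and I: "fractional_ideal K I"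
    and pow: "I [^]\<^bsub>G\<^esub> p \<in> H" and not_principal: "I \<notin> H"
  shows "p dvd class_number K"
proof -
  let ?C = "ideal_class_group K" and ?X = "H #>\<^bsub>G\<^esub> I"
  interpret C: group ?C unfolding ideal_class_group_def by (rule N.factorgroup_is_group)
  have I_carrier: "I \<in> carrier G" using I by simp
  then have X: "?X \<in> carrier ?C" unfolding ideal_class_group_def carrier_FactGroup by blast
  have one: "\<one>\<^bsub>?C\<^esub> = H" by (simp add: ideal_class_group_def)
  have "?X [^]\<^bsub>?C\<^esub> p = H #>\<^bsub>G\<^esub> (I [^]\<^bsub>G\<^esub> p)"
    unfolding ideal_class_group_def by (rule N.FactGroup_pow[OF I_carrier])
  also have "\<dots> = H" using pow N.subset N.subgroup_axioms by (intro G.coset_join2) auto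
  finally have "C.ord ?X dvd p" using C.pow_eq_id[OF X, of p] one by simp
  moreover have "?X \<noteq> H"
    using not_principal G.coset_join1[OF _ I_carrier N.subgroup_axioms] by blast
  then have "C.ord ?X \<noteq> 1" using C.ord_eq_1[OF X] one by simp
  ultimately have "C.ord ?X = p" using \<open>prime p\<close> by (auto simp: prime_nat_iff)
  then show ?thesis using C.ord_dvd_group_order[OF X] by (simp add: class_number_def)
qed

section \<open>Ideals with a two-element basis\<close>

text \<open>Only an integer span, so that membership amounts to a pair of integers. For nonzero
  \<open>n\<close> it is closed under \<open>R\<close> exactly when \<open>n\<close> divides
  \<open>c\<^sup>2 + D\<close>, and it is then the ideal generated by \<open>n\<close> and
  \<open>c + w\<close>.\<close>

definition basis_ideal :: "int \<Rightarrow> int \<Rightarrow> complex set" where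
  "basis_ideal c n = {of_int i * of_int n + of_int j * (of_int c + w) |i j. True}"

lemma basis_idealI: "x = of_int i * of_int n + of_int j * (of_int c + w) \<Longrightarrow> x \<in> basis_ideal c n"
  unfolding basis_ideal_def by blast

lemma basis_idealE:
  assumes "x \<in> basis_ideal c n"
  obtains i j where "x = of_int i * of_int n + of_int j * (of_int c + w)"
  using assms unfolding basis_ideal_def by blast

lemma basis_ideal_generators: "of_int n \<in> basis_ideal c n" "of_int c + w \<in> basis_ideal c n"
  by (rule basis_idealI[of _ 1 n 0 c], simp) (rule basis_idealI[of _ 0 n 1 c], simp)

lemma basis_ideal_subset_R: "basis_ideal c n \<subseteq> R"
  by (auto elim!: basis_idealE intro!: R_add R_mult R_of_int R_w)

lemma basis_ideal_add: "x \<in> basis_ideal c n \<Longrightarrow> y \<in> basis_ideal c n \<Longrightarrow> x + y \<in> basis_ideal c n"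
proof -
  assume "x \<in> basis_ideal c n" "y \<in> basis_ideal c n"
  then obtain i j i' j' where "x = of_int i * of_int n + of_int j * (of_int c + w)"
    "y = of_int i' * of_int n + of_int j' * (of_int c + w)"
    by (elim basis_idealE)
  then show ?thesis by (intro basis_idealI[of _ "i + i'" _ "j + j'"]) (simp add: algebra_simps)
qed

lemma generator_square: "(of_int c + w) * (of_int c + w) = of_int (2 * c) * (of_int c + w) - of_int (c\<^sup>2 + D)"
  by (simp add: power2_eq_square algebra_simps w_square)

lemma fractional_basis_ideal:
  assumes "n \<noteq> 0" "n dvd c\<^sup>2 + D"
  shows "fractional_ideal K (basis_ideal c n)"
proof -
  obtain q where q: "c\<^sup>2 + D = n * q" using assms(2) ..
  show ?thesis unfolding fractional_ideal_def
  proof (intro conjI ballI)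
    show "basis_ideal c n \<subseteq> K" using basis_ideal_subset_R R_subset_K by blast
    show "0 \<in> basis_ideal c n" by (rule basis_idealI[of _ 0 n 0 c]) simp
    show "basis_ideal c n \<noteq> {0}" using basis_ideal_generators(1)[of n c] assms(1) by force
    show "x + y \<in> basis_ideal c n" if "x \<in> basis_ideal c n" "y \<in> basis_ideal c n" for x y
      using that by (rule basis_ideal_add)
    show "r * x \<in> basis_ideal c n" if r: "r \<in> R" and x: "x \<in> basis_ideal c n" for r x
    proof -
      obtain a b where r: "r = of_int a + of_int b * w" using r unfolding R_iff by blast
      obtain i j where x: "x = of_int i * of_int n + of_int j * (of_int c + w)" using x by (rule basis_idealE)
      \<comment> \<open>Since 1 and \<open>c + w\<close> span \<open>R\<close>, closure has to be
        checked for multiplication by \<open>c + w\<close> only; there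
        \<open>generator_square\<close> applies and divisibility by \<open>n\<close> absorbs the
        constant term.\<close>
      have "r * x = of_int (a - b * c) * x + of_int b * ((of_int c + w) * x)"
        by (simp add: r algebra_simps)
      also have "(of_int c + w) * x = of_int i * of_int n * (of_int c + w) + of_int j * ((of_int c + w) * (of_int c + w))"
        by (simp add: x algebra_simps)
      also have "\<dots> = of_int (- j * q) * of_int n + of_int (i * n + j * 2 * c) * (of_int c + w)"
        unfolding generator_square q by (simp add: algebra_simps)
      finally show ?thesis
        unfolding x
        by (intro basis_idealI[of _ "(a - b * c) * i - b * j * q" _ "(a - b * c) * j + b * (i * n + j * 2 * c)"])
           (simp add: algebra_simps)
    qed
    show "\<exists>d\<in>R. d \<noteq> 0 \<and> (\<forall>x\<in>basis_ideal c n. d * x \<in> R)"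
      using basis_ideal_subset_R R_1 by (intro bexI[of _ 1]) auto
  qed
qed

text \<open>Write \<alpha> for \<open>c + w\<close>. The product contains \<open>n * k\<close>,
  \<open>n * \<alpha>\<close> and \<open>\<alpha> * \<alpha>\<close>, and the last equals
  \<open>2 * c * \<alpha>\<close> up to a multiple of \<open>n * k\<close>. Coprimality of
  \<open>n\<close> and \<open>2 * c\<close>, the trace of \<alpha>, then puts \<alpha> itself into
  the product. In this form the coprimality of \<alpha> with its conjugate enters.\<close>

lemma basis_ideal_mult:
  assumes "n \<noteq> 0" "k \<noteq> 0" "n * k dvd c\<^sup>2 + D" "coprime n (2 * c)"
  shows "basis_ideal c n \<star> basis_ideal c k = basis_ideal c (n * k)"
proof
  let ?\<alpha> = "of_int c + w"
  obtain q where q: "c\<^sup>2 + D = n * k * q" using assms(3) ..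
  show "basis_ideal c n \<star> basis_ideal c k \<subseteq> basis_ideal c (n * k)"
  proof (rule ideal_mult_subset)
    fix x y assume "x \<in> basis_ideal c n" "y \<in> basis_ideal c k"
    then obtain i j i' j' where x: "x = of_int i * of_int n + of_int j * ?\<alpha>"
      and y: "y = of_int i' * of_int k + of_int j' * ?\<alpha>"
      by (elim basis_idealE)
    have "x * y = of_int (i * i') * of_int (n * k) + of_int (i * n * j' + i' * k * j) * ?\<alpha>
        + of_int (j * j') * (?\<alpha> * ?\<alpha>)"
      by (simp add: x y algebra_simps)
    also have "\<dots> = of_int (i * i' - j * j' * q) * of_int (n * k)
        + of_int (i * n * j' + i' * k * j + j * j' * 2 * c) * ?\<alpha>"
      unfolding generator_square q by (simp add: algebra_simps)
    finally show "x * y \<in> basis_ideal c (n * k)" by (rule basis_idealI)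
  qed (rule basis_ideal_add)
  have frac: "fractional_ideal K (basis_ideal c n \<star> basis_ideal c k)"
    using assms by (intro fractional_ideal_mult fractional_basis_ideal) (auto intro: dvd_trans)
  note comb = fractional_ideal_int_combination[OF frac]
  have prod: "of_int (n * k) \<in> basis_ideal c n \<star> basis_ideal c k"
    using ideal_mult_prod[OF basis_ideal_generators(1) basis_ideal_generators(1)] by simp
  have n\<alpha>: "of_int n * ?\<alpha> \<in> basis_ideal c n \<star> basis_ideal c k"
    by (intro ideal_mult_prod basis_ideal_generators)
  have sq: "?\<alpha> * ?\<alpha> \<in> basis_ideal c n \<star> basis_ideal c k"
    by (intro ideal_mult_prod basis_ideal_generators)
  have "of_int (2 * c) * ?\<alpha> = of_int 1 * (?\<alpha> * ?\<alpha>) + of_int q * of_int (n * k)"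
    unfolding generator_square q by (simp add: algebra_simps)
  then have c\<alpha>: "of_int (2 * c) * ?\<alpha> \<in> basis_ideal c n \<star> basis_ideal c k"
    using comb[OF sq prod, of 1 q] by simp
  obtain u v where "u * n + v * (2 * c) = gcd n (2 * c)" using bezout_int by blast
  then have uv: "u * n + v * (2 * c) = 1" using assms(4) by simp
  have "?\<alpha> = of_int (u * n + v * (2 * c)) * ?\<alpha>" unfolding uv by simp
  also have "\<dots> = of_int u * (of_int n * ?\<alpha>) + of_int v * (of_int (2 * c) * ?\<alpha>)"
    by (simp add: algebra_simps)
  also have "\<dots> \<in> basis_ideal c n \<star> basis_ideal c k" by (rule comb[OF n\<alpha> c\<alpha>])
  finally have \<alpha>: "?\<alpha> \<in> basis_ideal c n \<star> basis_ideal c k" .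
  show "basis_ideal c (n * k) \<subseteq> basis_ideal c n \<star> basis_ideal c k"
  proof
    fix x assume "x \<in> basis_ideal c (n * k)"
    then obtain i j where "x = of_int i * of_int (n * k) + of_int j * ?\<alpha>" by (rule basis_idealE)
    then show "x \<in> basis_ideal c n \<star> basis_ideal c k" using comb[OF prod \<alpha>] by (simp only:)
  qed
qed

lemma basis_ideal_1: "basis_ideal c 1 = R"
proof
  show "R \<subseteq> basis_ideal c 1"
  proof
    fix x assume "x \<in> R"
    then obtain a b where "x = of_int a + of_int b * w" unfolding R_iff by blast
    then show "x \<in> basis_ideal c 1" by (intro basis_idealI[of _ "a - b * c" _ b]) (simp add: algebra_simps)
  qed
qed (rule basis_ideal_subset_R)

lemma basis_ideal_pow:
  assumes "n \<noteq> 0" "coprime n (2 * c)" "n ^ k dvd c\<^sup>2 + D"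
  shows "basis_ideal c n [^]\<^bsub>G\<^esub> k = basis_ideal c (n ^ k)"
  using assms(3)
proof (induction k)
  case 0
  then show ?case by (simp add: basis_ideal_1)
next
  case (Suc k)
  then have "n ^ k dvd c\<^sup>2 + D" by (auto intro: dvd_trans)
  moreover have "n ^ k * n dvd c\<^sup>2 + D" using Suc.prems by (simp add: mult.commute)
  then have "basis_ideal c (n ^ k) \<star> basis_ideal c n = basis_ideal c (n ^ k * n)"
    using assms(1,2) by (intro basis_ideal_mult) simp_all
  ultimately show ?case using Suc.IH by (simp add: mult.commute)
qed

lemma basis_ideal_norm: "basis_ideal c (c\<^sup>2 + D) = (*) (of_int c + w) ` R"
proof -
  \<comment> \<open>With \<alpha> = \<open>c + w\<close> the integer \<open>c\<^sup>2 + D\<close> is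
    \<alpha> times its conjugate, so \<alpha> can be factored out; the cofactor is \<open>j\<close>
    plus \<open>i\<close> times the conjugate of \<alpha>.\<close>
  have eq: "of_int i * of_int (c\<^sup>2 + D) + of_int j * (of_int c + w)
      = (of_int c + w) * (of_int (j + i * c) + of_int (- i) * w)" for i j
    by (simp add: power2_eq_square algebra_simps w_square)
  show ?thesis
  proof
    show "basis_ideal c (c\<^sup>2 + D) \<subseteq> (*) (of_int c + w) ` R"
    proof
      fix x assume "x \<in> basis_ideal c (c\<^sup>2 + D)"
      then obtain i j where "x = of_int i * of_int (c\<^sup>2 + D) + of_int j * (of_int c + w)"
        by (rule basis_idealE)
      then show "x \<in> (*) (of_int c + w) ` R"
        unfolding eq by (rule image_eqI) (intro R_add R_mult R_of_int R_w)
    qed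
    show "(*) (of_int c + w) ` R \<subseteq> basis_ideal c (c\<^sup>2 + D)"
    proof
      fix x assume "x \<in> (*) (of_int c + w) ` R"
      then obtain r where r: "r \<in> R" "x = (of_int c + w) * r" by blast
      then obtain a b where "r = of_int a + of_int b * w" unfolding R_iff by blast
      with r(2) have "x = (of_int c + w) * (of_int a + of_int b * w)" by simp
      then show "x \<in> basis_ideal c (c\<^sup>2 + D)"
        by (intro basis_idealI[of _ "- b" _ "a + b * c"]) (simp only: eq, simp)
    qed
  qed
qed

section \<open>Moduli of generators and non-principality\<close>

lemma R_cmod_ge_1: "x \<in> R \<Longrightarrow> x \<noteq> 0 \<Longrightarrow> cmod x \<ge> 1"
proof -
  assume "x \<in> R" "x \<noteq> 0"
  then obtain n :: nat where n: "(cmod x)\<^sup>2 = real n" using R_cmod_square by blast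
  then have "n \<noteq> 0" using \<open>x \<noteq> 0\<close> by (intro notI) simp
  then have "1\<^sup>2 \<le> (cmod x)\<^sup>2" by (simp add: n)
  then show ?thesis by (rule power2_le_imp_le) simp
qed

lemma cmod_square_coordinates: "(cmod (of_int a + of_int b * w))\<^sup>2 = of_int (a\<^sup>2 + D * b\<^sup>2)"
  using D_gt_1 by (simp add: cmod_power2 power_mult_distrib)

text \<open>Each generator is a multiple of the other by an element of \<open>R\<close>, and nonzero
  elements of \<open>R\<close> have modulus at least 1. This replaces a theory of ideal norms and of
  units.\<close>

lemma principal_eq_imp_cmod_eq:
  assumes "(*) a ` R = (*) b ` R"
  shows "cmod a = cmod b"
proof -
  have le: "cmod b \<le> cmod a" if "a \<in> (*) b ` R" "a \<noteq> 0" for a b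
  proof -
    obtain r where r: "r \<in> R" "a = b * r" using \<open>a \<in> (*) b ` R\<close> by blast
    then have "cmod r \<ge> 1" using that(2) by (intro R_cmod_ge_1) auto
    then show ?thesis using mult_left_mono[of 1 "cmod r" "cmod b"] by (simp add: r norm_mult)
  qed
  have "a \<in> (*) a ` R" "b \<in> (*) b ` R" using R_1 by (force intro: rev_image_eqI)+
  then have mem: "a \<in> (*) b ` R" "b \<in> (*) a ` R" by (simp_all add: assms)
  then show ?thesis using le[OF mem(1)] le[OF mem(2)] by (cases "a = 0"; cases "b = 0") auto
qed

text \<open>The modulus of a generator \<open>b\<close> is read off from the \<open>k\<close>-th
  power of the ideal: \<open>b ^ k\<close> and \<open>c + w\<close> generate the same ideal, so
  \<open>b\<close> has modulus \<open>n\<close>. Then \<open>n\<^sup>2 < D\<close> leaves no room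
  for a \<open>w\<close>-coordinate, and the rational integer \<open>b\<close> would divide both
  coordinates of \<open>c + w\<close>.\<close>

lemma basis_ideal_not_principal:
  assumes k: "k > 0" and n: "n > 1" "n\<^sup>2 < D" and norm: "c\<^sup>2 + D = (n\<^sup>2) ^ k"
    and coprime: "coprime n (2 * c)"
  shows "basis_ideal c (n\<^sup>2) \<notin> H"
proof
  assume "basis_ideal c (n\<^sup>2) \<in> H"
  then obtain b where b: "basis_ideal c (n\<^sup>2) = (*) b ` R" unfolding H_iff by blast
  have "(*) (b ^ k) ` R = basis_ideal c (n\<^sup>2) [^]\<^bsub>G\<^esub> k" unfolding b principal_pow ..
  also have "\<dots> = basis_ideal c ((n\<^sup>2) ^ k)"
    using n(1) coprime norm by (intro basis_ideal_pow) simp_all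
  also have "\<dots> = (*) (of_int c + w) ` R" by (simp only: norm[symmetric] basis_ideal_norm)
  finally have "cmod (b ^ k) = cmod (of_int c + w)" by (rule principal_eq_imp_cmod_eq)
  then have "(cmod b ^ k)\<^sup>2 = (cmod (of_int c + of_int 1 * w))\<^sup>2" by (simp add: norm_power)
  also have "\<dots> = of_int (c\<^sup>2 + D)" unfolding cmod_square_coordinates by simp
  also have "\<dots> = (of_int n ^ k)\<^sup>2" unfolding norm by (simp add: power_mult[symmetric] mult.commute)
  finally have "cmod b ^ k = of_int n ^ k" using n(1) by (simp add: power2_eq_iff_nonneg)
  then have cmod_b: "cmod b = of_int n" by (rule power_eq_imp_eq_base) (use k n(1) in simp_all)
  have "b \<in> (*) b ` R" using R_1 by (force intro: rev_image_eqI)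
  then have "b \<in> R" using basis_ideal_subset_R by (auto simp flip: b)
  then obtain u v where uv: "b = of_int u + of_int v * w" unfolding R_iff by blast
  have "real_of_int (u\<^sup>2 + D * v\<^sup>2) = of_int (n\<^sup>2)"
    using cmod_square_coordinates[of u v] by (simp add: uv[symmetric] cmod_b)
  then have eq: "u\<^sup>2 + D * v\<^sup>2 = n\<^sup>2" by (simp only: of_int_eq_iff)
  have "v = 0"
  proof (rule ccontr)
    assume "v \<noteq> 0"
    then have "1 \<le> v\<^sup>2" by (simp add: int_one_le_iff_zero_less)
    then have "D * 1 \<le> D * v\<^sup>2" using D_gt_1 by (intro mult_left_mono) simp_all
    then show False using eq n(2) zero_le_power2[of u] by linarith
  qed
  have "of_int c + w \<in> (*) b ` R" using basis_ideal_generators(2) b by blast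
  then obtain r where "r \<in> R" "of_int c + w = b * r" by blast
  then obtain s t where "of_int c + w = of_int u * (of_int s + of_int t * w)"
    unfolding R_iff uv \<open>v = 0\<close> by auto
  \<comment> \<open>The \<open>w\<close>-coordinate of \<open>c + w\<close> is 1, so
    \<open>u\<close> is a unit, contrary to \<open>n > 1\<close>.\<close>
  from arg_cong[OF this, of Im] have "sqrt D = u * (t * sqrt D)" by simp
  then have "real_of_int (u * t) = 1" using D_gt_1 by simp
  then have "u * t = 1" by (simp only: of_int_eq_1_iff)
  then have "u\<^sup>2 = 1" by (auto simp: zmult_eq_1_iff)
  then have "n\<^sup>2 = 1" using eq \<open>v = 0\<close> by simp
  then show False using n(1) by (simp add: power2_eq_1_iff)
qed

end

theorem theorem8:
  fixes m :: int and p :: nat and K :: "complex set"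
  assumes "m \<ge> 3" and "odd m"
    and "prime p" and "odd p"
    and "squarefree (2 * m ^ p - 1)"
  defines "K \<equiv> rat_adjoin (csqrt (of_int (1 - 2 * m ^ p)))"
  shows "finite (carrier (ideal_class_group K)) \<and> p dvd class_number K"
proof -
  define D where "D = 2 * m ^ p - 1"
  define c where "c = 1 - m ^ p"
  have "p \<noteq> 2" using \<open>odd p\<close> by auto
  then have p: "p \<ge> 3" using prime_ge_2_nat[OF \<open>prime p\<close>] by simp
  \<comment> \<open>The chain of estimates gives \<open>D \<ge> 6 * m\<^sup>2 - 1\<close>, well
    above the required \<open>m\<^sup>2\<close>.\<close>
  have "m ^ 3 \<le> m ^ p" using assms(1) p by (intro power_increasing) simp_all
  moreover have "3 * m\<^sup>2 \<le> m ^ 3"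
    using assms(1) mult_right_mono[of 3 m "m\<^sup>2"] by (simp add: power3_eq_cube power2_eq_square)
  moreover have "m\<^sup>2 \<ge> 3\<^sup>2" using assms(1) by (intro power_mono) simp_all
  ultimately have D: "m\<^sup>2 < D" "D > 1" by (simp_all add: D_def)
  have "odd (m ^ p)" using \<open>odd m\<close> by simp
  then obtain k where "m ^ p = 2 * k + 1" by (elim oddE)
  then have "D mod 4 = 1" by (simp add: D_def)
  then interpret imaginary_quadratic D
    using D(2) assms(5) by unfold_locales (simp_all add: D_def)
  have K: "K = rat_adjoin w" unfolding K_def w_def by (simp add: D_def)
  have norm: "c\<^sup>2 + D = (m\<^sup>2) ^ p"
    by (simp add: c_def D_def power2_eq_square algebra_simps power_mult_distrib)
  \<comment> \<open>A common divisor of \<open>m\<close> and \<open>c\<close> divides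
    \<open>c + m ^ p = 1\<close>.\<close>
  have "coprime m c"
  proof (rule coprimeI)
    fix d assume d: "d dvd m" "d dvd c"
    have "d dvd m ^ p" using d(1) dvd_power[of p m] p by (auto intro: dvd_trans)
    from dvd_add[OF d(2) this] show "is_unit d" by (simp add: c_def)
  qed
  then have "coprime m (2 * c)" using \<open>odd m\<close> by simp
  have I: "fractional_ideal (rat_adjoin w) (basis_ideal c (m\<^sup>2))"
    using assms(1) norm p by (intro fractional_basis_ideal) (simp_all add: dvd_power)
  have "basis_ideal c (m\<^sup>2) [^]\<^bsub>fractional_ideal_group (rat_adjoin w)\<^esub> p = basis_ideal c ((m\<^sup>2) ^ p)"
    using assms(1) norm \<open>coprime m (2 * c)\<close> by (intro basis_ideal_pow) simp_all
  also have "\<dots> = (*) (of_int c + w) ` ring_of_integers (rat_adjoin w)"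
    by (simp only: norm[symmetric] basis_ideal_norm)
  also have "\<dots> \<in> principal_fractional_ideals (rat_adjoin w)"
  proof -
    \<comment> \<open>Its imaginary part is \<open>sqrt D\<close>, which is positive.\<close>
    have "of_int c + w \<noteq> 0" using D(2) by (auto simp: complex_eq_iff)
    then show ?thesis unfolding H_iff by (intro bexI[of _ "of_int c + w"] K_add K_of_int K_w) simp_all
  qed
  finally have "p dvd class_number (rat_adjoin w)"
    using assms(1) p D(1) norm \<open>coprime m (2 * c)\<close>
    by (intro class_number_dvd[OF \<open>prime p\<close> I] basis_ideal_not_principal[of p]) simp_all
  then show ?thesis using finite_class_group K by simp
qed

end
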